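(* For every $n\ge1$, \[ k_n(\lambda)=-\sum_{\pi\in\mathcal{P}^c(n)}(-\lambda)^{\#\pi}\,T_{G(\pi)}(1,0). \]
   Context: Let $\lambda$ be a formal variable (or $\lambda>0$). The moments of the free Poisson law are $m_n(\lambda)=\sum_{\pi\in\mathcal{NC}(n)}\lambda^{\#\pi}$, where $\mathcal{NC}(n)$ is the set of noncrossing set partitions of $\{1,\dots,n\}$ and $\#\pi$ is the number of blocks; $m_0(\lambda)=1$. Its cumulants $k_n(\lambda)$ are defined by $\sum_{n\ge1}k_n(\lambda)\frac{z^n}{n!}=\log\big(\sum_{n\ge0}m_n(\lambda)\frac{z^n}{n!}\big)$. $\mathcal{P}^c(n)$ is the set of connected set partitions of $\{1,\dots,n\}$: those $\pi$ such that no proper subinterval of $\{1,\dots,n\}$ is a union of blocks of $\pi$. For a set partition $\pi$, its crossing graph $G(\pi)$ has the blocks of $\pi$ as vertices, with an edge between blocks $b,c$ iff $\{b,c\}$ is not a noncrossing partition of $b\cup c$ (i.e. there exist $i<k<j<\ell$ with $i,j\in b$, $k,\ell\in c$ or vice versa). $T_G(x,y)$ denotes the Tutte polynomial. *)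

theory Defs
  imports
    "HOL-Library.Disjoint_Sets"
    "HOL-Computational_Algebra.Formal_Power_Series"
begin

text \<open>
  The condition \<open>b \<noteq> c\<close> is needed: a single block with four or more elements would satisfy
  the inequalities with itself.
\<close>

definition crosses :: "nat set \<Rightarrow> nat set \<Rightarrow> bool" where
  "crosses b c \<longleftrightarrow> b \<noteq> c \<and>
     (\<exists>i k j l. i < k \<and> k < j \<and> j < l \<and>
        ((i \<in> b \<and> j \<in> b \<and> k \<in> c \<and> l \<in> c) \<or> (i \<in> c \<and> j \<in> c \<and> k \<in> b \<and> l \<in> b)))"

definition noncrossing_partitions :: "nat \<Rightarrow> nat set set set" where
  "noncrossing_partitions n =
     {P. partition_on {1..n} P \<and> (\<forall>b\<in>P. \<forall>c\<in>P. \<not> crosses b c)}"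

text \<open>
  Subintervals are nonempty (\<open>a \<le> b\<close>); the empty interval is trivially a union of no blocks.
\<close>

definition connected_partitions :: "nat \<Rightarrow> nat set set set" where
  "connected_partitions n =
     {P. partition_on {1..n} P \<and>
         \<not> (\<exists>a b. a \<le> b \<and> {a..b} \<subset> {1..n} \<and> (\<exists>Q\<subseteq>P. \<Union>Q = {a..b}))}"

text \<open>
  The parameter ranges over an arbitrary field of characteristic 0. A formal variable is the
  case of a transcendental element, such as \<open>fls_X :: rat fls\<close>; a positive real number is
  the case \<open>'a = real\<close>.
\<close>

definition free_poisson_moment :: "nat \<Rightarrow> 'a::field_char_0 \<Rightarrow> 'a" where
  "free_poisson_moment n lam = (\<Sum>P\<in>noncrossing_partitions n. lam ^ card P)"

text \<open>
  Since \<open>fps_ln 1\<close> is the series of log(1 + z), the series composed with it must have 1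
  subtracted.
\<close>

definition free_poisson_cumulant :: "nat \<Rightarrow> 'a::field_char_0 \<Rightarrow> 'a" where
  "free_poisson_cumulant n lam =
     fact n * fps_nth (fps_ln 1 oo (Abs_fps (\<lambda>m. free_poisson_moment m lam / fact m) - 1)) n"

text \<open>
  A graph is a pair of a finite vertex set and a set of edges, each edge being the set of its
  two endpoints.
\<close>

type_synonym 'v graph = "'v set \<times> 'v set set"

definition crossing_graph :: "nat set set \<Rightarrow> nat set graph" where
  "crossing_graph P = (P, {{b, c} | b c. b \<in> P \<and> c \<in> P \<and> crosses b c})"

definition num_components :: "'v set \<Rightarrow> 'v set set \<Rightarrow> nat" where
  "num_components V A = card (V // {(u, v) \<in> V \<times> V. (u, v) \<in> {(u, v). {u, v} \<in> A}\<^sup>*})"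

text \<open>
  The Tutte polynomial as the rank generating sum over spanning subgraphs \<open>(V, A)\<close>.
  The truncated subtractions in the exponents are exact, because
  \<open>num_components V A \<ge> num_components V E\<close> and
  \<open>num_components V A + card A \<ge> card V\<close>; moreover \<open>0 ^ 0 = 1\<close>, so the
  expression can be evaluated at \<open>x = 1\<close> or \<open>y = 1\<close>.
\<close>

definition tutte :: "'v graph \<Rightarrow> 'a::comm_ring_1 \<Rightarrow> 'a \<Rightarrow> 'a" where
  "tutte G x y = (case G of (V, E) \<Rightarrow>
     \<Sum>A\<in>Pow E. (x - 1) ^ (num_components V A - num_components V E) *
                 (y - 1) ^ (num_components V A + card A - card V))"

end

(*
  For a connected graph on v vertices, T(1,0) is (-1)^(v+1) times the sum of (-1)^|A| over the
  connected spanning edge sets A, and a set partition has a connected crossing graph iff it is a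
  connected partition. So the right-hand side is the sum over all partitions P of lam^|P| times
  the sum of (-1)^|A| over the A that connect the crossing graph of P. Without connectedness, the
  alternating sum over all edge sets A is the indicator that P is noncrossing, whose weighted sum is
  the moment. Splitting off the component of (P, A) containing a fixed point x of [n + 1] turns
  this into m_(n+1) = sum_i binom(n, i) k_(i+1) m_(n-i), which is the coefficient form
  of M' = K' M, and hence determines the cumulants.
*)

theory Submission
  imports Defs "HOL-Library.Infinite_Set"
begin

subsection \<open>Alternating sums over spanning subgraphs\<close>

text \<open>This is the relation inside \<open>num_components\<close>, so that
  \<open>connects\<close> can be compared with the number of components.\<close>

definition adj :: "'v set set \<Rightarrow> ('v \<times> 'v) set" where
  "adj A = {(u, v). {u, v} \<in> A}"

definition connects :: "'v set \<Rightarrow> 'v set set \<Rightarrow> bool" where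
  "connects V A \<longleftrightarrow> (\<forall>u\<in>V. \<forall>v\<in>V. (u, v) \<in> (adj A)\<^sup>*)"

text \<open>Up to sign this is T(1,0) of a connected graph, see \<open>tutte_1_0\<close>. For a
  disconnected graph the sum is empty.\<close>

definition conn_sum :: "'v set \<Rightarrow> 'v set set \<Rightarrow> 'a::comm_ring_1" where
  "conn_sum V E = (\<Sum>A | A \<subseteq> E \<and> connects V A. (-1) ^ card A)"

lemma sym_adj: "sym (adj A)"
  by (auto simp: adj_def sym_def insert_commute)

lemma adj_rtrancl_sym: "(u, v) \<in> (adj A)\<^sup>* \<Longrightarrow> (v, u) \<in> (adj A)\<^sup>*"
  by (rule symD[OF sym_rtrancl[OF sym_adj]])

lemma adj_mono: "A \<subseteq> B \<Longrightarrow> adj A \<subseteq> adj B"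
  by (auto simp: adj_def)

lemma adj_rtrancl_invariant:
  assumes "(u, v) \<in> (adj A)\<^sup>*" "u \<in> C"
    and "\<And>a b. {a, b} \<in> A \<Longrightarrow> a \<in> C \<Longrightarrow> b \<in> C"
  shows "v \<in> C"
  using assms(1,2) by (induction rule: rtrancl_induct) (auto simp: adj_def assms(3))

lemma connects_from:
  assumes "\<And>v. v \<in> V \<Longrightarrow> (x, v) \<in> (adj A)\<^sup>*"
  shows "connects V A"
  unfolding connects_def
  by (meson adj_rtrancl_sym assms rtrancl_trans)

text \<open>Expand the product of -1 + 1 over \<open>A\<close>: it is
  \<open>0 ^ card A\<close>.\<close>

lemma sum_Pow_neg_one:
  assumes "finite A"
  shows "(\<Sum>X\<in>Pow A. (-1) ^ card X :: 'a::comm_ring_1) = (if A = {} then 1 else 0)"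
  using prod_add[OF assms, of "\<lambda>_. -1 :: 'a" "\<lambda>_. 1"] assms
  by (cases "A = {}") (simp_all add: power_0_left)

text \<open>The component \<open>C\<close> is closed under adjacency, so no edge joins it to its
  complement, and a path from \<open>x\<close> uses only edges inside \<open>C\<close>.\<close>

lemma component_edges:
  assumes "A \<subseteq> E" "E \<subseteq> {{u, v} | u v. u \<in> V \<and> v \<in> V}" "x \<in> V"
    and C: "C = {v. (x, v) \<in> (adj A)\<^sup>*}"
  shows "C \<subseteq> V" "x \<in> C" "A = A \<inter> Pow C \<union> A \<inter> Pow (V - C)" "connects C (A \<inter> Pow C)"
proof -
  have closed: "b \<in> C" if "{a, b} \<in> A" "a \<in> C" for a b
  proof -
    have "(x, a) \<in> (adj A)\<^sup>*" "(a, b) \<in> adj A" using that by (simp_all add: C adj_def)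
    then show ?thesis unfolding C by (simp add: rtrancl_into_rtrancl)
  qed
  show "C \<subseteq> V"
  proof
    fix v assume "v \<in> C"
    then have "(x, v) \<in> (adj A)\<^sup>*" by (simp add: C)
    moreover have "b \<in> V" if "{a, b} \<in> A" for a b
    proof -
      have "{a, b} \<in> {{u, v} | u v. u \<in> V \<and> v \<in> V}" using that assms(1,2) by blast
      then show ?thesis by (auto simp: doubleton_eq_iff)
    qed
    ultimately show "v \<in> V" using adj_rtrancl_invariant[of x v A V] assms(3) by blast
  qed
  show "x \<in> C" by (simp add: C)
  show "A = A \<inter> Pow C \<union> A \<inter> Pow (V - C)"
  proof -
    have "e \<subseteq> C \<or> e \<subseteq> V - C" if "e \<in> A" for e
    proof -
      have "e \<in> {{u, v} | u v. u \<in> V \<and> v \<in> V}" using that assms(1,2) by blast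
      then obtain u v where e: "e = {u, v}" "u \<in> V" "v \<in> V" by blast
      have "{v, u} \<in> A" "{u, v} \<in> A" using that e by (auto simp: insert_commute)
      then show ?thesis using closed[of u v] closed[of v u] e by auto
    qed
    then show ?thesis by blast
  qed
  show "connects C (A \<inter> Pow C)"
  proof (rule connects_from[of _ x])
    fix v assume "v \<in> C"
    then have "(x, v) \<in> (adj A)\<^sup>*" by (simp add: C)
    then show "(x, v) \<in> (adj (A \<inter> Pow C))\<^sup>*"
    proof (induction rule: rtrancl_induct)
      case (step y z)
      have "y \<in> C" using step(1) by (simp add: C)
      moreover have "z \<in> C" using rtrancl_into_rtrancl[OF step(1,2)] by (simp add: C)
      ultimately have "(y, z) \<in> adj (A \<inter> Pow C)" using step(2) by (auto simp: adj_def)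
      then show ?case using step(3) by (rule rtrancl_into_rtrancl[rotated])
    qed simp
  qed
qed

text \<open>Converse to \<open>component_edges\<close>: edges off \<open>C\<close> cannot enlarge
  the component of \<open>x\<close>, and \<open>A1\<close> alone already reaches all of
  \<open>C\<close>.\<close>

lemma component_Un:
  assumes "A1 \<subseteq> Pow C" "A2 \<subseteq> Pow (V - C)" "connects C A1" "x \<in> C"
  shows "{v. (x, v) \<in> (adj (A1 \<union> A2))\<^sup>*} = C"
proof
  show "{v. (x, v) \<in> (adj (A1 \<union> A2))\<^sup>*} \<subseteq> C"
  proof
    fix v assume "v \<in> {v. (x, v) \<in> (adj (A1 \<union> A2))\<^sup>*}"
    moreover have "b \<in> C" if "{a, b} \<in> A1 \<union> A2" "a \<in> C" for a b
      using that assms(1,2) by auto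
    ultimately show "v \<in> C" using adj_rtrancl_invariant[of x v "A1 \<union> A2" C] assms(4) by blast
  qed
  show "C \<subseteq> {v. (x, v) \<in> (adj (A1 \<union> A2))\<^sup>*}"
    using assms(3,4) rtrancl_mono[OF adj_mono[of A1 "A1 \<union> A2"]] unfolding connects_def by blast
qed

text \<open>The left side is the alternating sum over all edge sets. Sorted by the component
  \<open>C\<close> of \<open>x\<close>, each splits into a connected spanning edge set on
  \<open>C\<close> and an arbitrary one on \<open>V - C\<close>, whose alternating sum collapses to
  an indicator again.\<close>

lemma edgeless_eq_sum_conn_sum:
  assumes "finite V" "E \<subseteq> {{u, v} | u v. u \<in> V \<and> v \<in> V}" "{} \<notin> E" "x \<in> V"
  shows "(if E = {} then 1 else 0 :: 'a::comm_ring_1) =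
    (\<Sum>C | C \<subseteq> V \<and> x \<in> C. conn_sum C (E \<inter> Pow C) * (if E \<inter> Pow (V - C) = {} then 1 else 0))"
proof -
  define K where "K A = {v. (x, v) \<in> (adj A)\<^sup>*}" for A
  have "E \<subseteq> Pow V" using assms(2) by auto
  then have finE: "finite E" using assms(1) finite_subset by auto
  have "(if E = {} then 1 else 0 :: 'a) = (\<Sum>A\<in>Pow E. (-1) ^ card A)"
    using sum_Pow_neg_one[OF finE, where 'a='a] by simp
  also have "\<dots> = (\<Sum>C | C \<subseteq> V \<and> x \<in> C. \<Sum>A | A \<in> Pow E \<and> K A = C. (-1) ^ card A)"
    using finE assms component_edges(1,2)[OF _ assms(2,4)]
    by (intro sum.group[symmetric]) (auto simp: K_def)
  also have "\<dots> = (\<Sum>C | C \<subseteq> V \<and> x \<in> C. conn_sum C (E \<inter> Pow C) * (if E \<inter> Pow (V - C) = {} then 1 else 0))"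
  proof (rule sum.cong[OF refl])
    fix C assume C: "C \<in> {C. C \<subseteq> V \<and> x \<in> C}"
    have "(\<Sum>A | A \<in> Pow E \<and> K A = C. (-1) ^ card A :: 'a) =
      (\<Sum>(A1, A2) \<in> {A. A \<subseteq> E \<inter> Pow C \<and> connects C A} \<times> Pow (E \<inter> Pow (V - C)).
         (-1) ^ card A1 * (-1) ^ card A2)"
    proof (rule sum.reindex_bij_witness[of _ "\<lambda>(A1, A2). A1 \<union> A2" "\<lambda>A. (A \<inter> Pow C, A \<inter> Pow (V - C))"],
        goal_cases)
      case (1 A)
      then show ?case using component_edges(3)[OF _ assms(2,4), of A C] by (auto simp: K_def)
    next
      case (2 A)
      then show ?case using component_edges(4)[OF _ assms(2,4), of A C] by (auto simp: K_def)
    next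
      case (3 p)
      obtain A1 A2 where p: "p = (A1, A2)" by fastforce
      \<comment> \<open>Only the empty set lies in both \<open>Pow C\<close> and
        \<open>Pow (V - C)\<close>, and no edge is empty; hence both parts can be recovered from
        their union.\<close>
      have "e \<notin> Pow C \<or> e \<notin> Pow (V - C)" if "e \<in> E" for e
      proof (rule ccontr)
        assume "\<not> ?thesis"
        then have "e = {}" by blast
        then show False using that assms(3) by simp
      qed
      moreover have "A1 \<subseteq> E \<inter> Pow C" "A2 \<subseteq> E \<inter> Pow (V - C)" using 3 p by auto
      ultimately have "(A1 \<union> A2) \<inter> Pow C = A1" "(A1 \<union> A2) \<inter> Pow (V - C) = A2" by blast+
      then show ?case using p by simp
    next
      case (4 p)
      obtain A1 A2 where p: "p = (A1, A2)" by fastforce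
      then have A: "A1 \<subseteq> E \<inter> Pow C" "A2 \<subseteq> E \<inter> Pow (V - C)" "connects C A1" using 4 by auto
      then have "K (A1 \<union> A2) = C"
        using component_Un[of A1 C A2 V x] C by (simp add: K_def)
      then show ?case using A p by auto
    next
      case (5 A)
      have "A = A \<inter> Pow C \<union> A \<inter> Pow (V - C)"
        using 5 component_edges(3)[OF _ assms(2,4), of A C] by (auto simp: K_def)
      moreover have "(A \<inter> Pow C) \<inter> (A \<inter> Pow (V - C)) = {}"
      proof (rule ccontr)
        assume "\<not> ?thesis"
        then obtain e where "e \<in> A" "e \<subseteq> C" "e \<subseteq> V - C" by blast
        then have "{} \<in> A" by (metis Diff_disjoint le_inf_iff subset_empty)
        then show False using 5 assms(3) by auto
      qed
      moreover have "finite A" using 5 finE finite_subset by auto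
      ultimately have "card A = card (A \<inter> Pow C) + card (A \<inter> Pow (V - C))"
        by (metis card_Un_disjoint finite_Int)
      then show ?case by (simp add: power_add)
    qed
    also have "\<dots> = conn_sum C (E \<inter> Pow C) * (\<Sum>A\<in>Pow (E \<inter> Pow (V - C)). (-1) ^ card A)"
      unfolding conn_sum_def sum_product sum.cartesian_product ..
    also have "\<dots> = conn_sum C (E \<inter> Pow C) * (if E \<inter> Pow (V - C) = {} then 1 else 0)"
      using sum_Pow_neg_one[of "E \<inter> Pow (V - C)", where 'a='a] finE by simp
    finally show "(\<Sum>A | A \<in> Pow E \<and> K A = C. (-1) ^ card A :: 'a) = \<dots>" .
  qed
  finally show ?thesis .
qed

section \<open>The Tutte polynomial at (1,0)\<close>

lemma connects_card_le:
  assumes "finite A" "connects V A" "finite V"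
  shows "card V \<le> Suc (card A)"
proof (cases "V = {}")
  case False
  then obtain r where r: "r \<in> V" by auto
  \<comment> \<open>The distance from the root \<open>r\<close>. Every other vertex has a neighbour
    \<open>p v\<close> closer to \<open>r\<close>, its parent in a breadth-first tree.\<close>
  define d where "d v = (LEAST n. (r, v) \<in> adj A ^^ n)" for v
  have d: "(r, v) \<in> adj A ^^ d v" if "v \<in> V" for v
  proof -
    have "(r, v) \<in> (adj A)\<^sup>*" using assms(2) r that by (simp add: connects_def)
    then have "\<exists>n. (r, v) \<in> adj A ^^ n" by (rule rtrancl_imp_relpow)
    then show ?thesis unfolding d_def by (rule LeastI_ex)
  qed
  have "\<exists>u. {u, v} \<in> A \<and> d u < d v" if "v \<in> V - {r}" for v
  proof -
    have dv: "(r, v) \<in> adj A ^^ d v" "r \<noteq> v" using d that by auto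
    then obtain k where k: "d v = Suc k" by (metis not0_implies_Suc relpow_0_E)
    then obtain u where u: "(r, u) \<in> adj A ^^ k" "(u, v) \<in> adj A"
      using dv(1) by (metis relpow_Suc_E)
    have "d u \<le> k" unfolding d_def by (rule Least_le) (rule u)
    then show ?thesis using u(2) k by (auto simp: adj_def)
  qed
  then obtain p where p: "\<And>v. v \<in> V - {r} \<Longrightarrow> {p v, v} \<in> A \<and> d (p v) < d v" by metis
  \<comment> \<open>Two distinct vertices with the same parent edge would be each other's parents,
    but \<open>d\<close> decreases towards the parent.\<close>
  have "inj_on (\<lambda>v. {p v, v}) (V - {r})"
  proof (rule inj_onI)
    fix v w assume "v \<in> V - {r}" "w \<in> V - {r}" "{p v, v} = {p w, w}"
    then show "v = w" using p[of v] p[of w] by (auto simp: doubleton_eq_iff)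
  qed
  then have "card (V - {r}) \<le> card A"
    using p assms(1) by (intro card_inj_on_le) auto
  then show ?thesis using r assms(3) by (simp add: card_Diff_singleton)
qed simp

text \<open>Nonemptiness matters: \<open>connects {} A\<close> holds, but the empty vertex set has 0
  components.\<close>

lemma num_components_eq_1_iff:
  assumes "V \<noteq> {}"
  shows "num_components V A = 1 \<longleftrightarrow> connects V A"
proof -
  define R where "R = {(u, v) \<in> V \<times> V. (u, v) \<in> (adj A)\<^sup>*}"
  have R: "num_components V A = card (V // R)" by (simp add: num_components_def R_def adj_def)
  have "equiv V R"
    by (rule equivI) (auto simp: R_def refl_on_def sym_def trans_def
        dest: adj_rtrancl_sym rtrancl_trans)
  obtain x where x: "x \<in> V" using assms by auto
  show ?thesis
  proof
    assume "num_components V A = 1"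
    then obtain X where X: "V // R = {X}" unfolding R by (auto simp: card_1_singleton_iff)
    have "R `` {u} = R `` {v}" if "u \<in> V" "v \<in> V" for u v
      using that X by (metis quotientI singletonD)
    then have "(u, v) \<in> R" if "u \<in> V" "v \<in> V" for u v
      using that \<open>equiv V R\<close> by (metis eq_equiv_class)
    then show "connects V A" by (auto simp: connects_def R_def)
  next
    assume "connects V A"
    then have "R = V \<times> V" by (auto simp: R_def connects_def)
    then have "V // R = {V}" using x by (auto simp: quotient_def)
    then show "num_components V A = 1" by (simp add: R)
  qed
qed

lemma num_components_pos:
  assumes "finite V" "V \<noteq> {}"
  shows "num_components V A > 0"
  using assms unfolding num_components_def
  by (subst card_gt_0_iff) (auto simp: quotient_def)

text \<open>At x = 1 a power of x - 1 vanishes unless its exponent is 0, so only the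
  \<open>A\<close> that connect \<open>V\<close> survive; at y = 0 each of them contributes a
  sign.\<close>

lemma tutte_1_0:
  assumes "finite V" "V \<noteq> {}" "finite E" "connects V E"
  shows "tutte (V, E) 1 0 = (-1) ^ Suc (card V) * (conn_sum V E :: 'a::comm_ring_1)"
proof -
  have "tutte (V, E) 1 0 = (\<Sum>A\<in>Pow E. if connects V A then (-1) ^ Suc (card V) * (-1) ^ card A else 0 :: 'a)"
    unfolding tutte_def prod.case
  proof (rule sum.cong[OF refl])
    fix A assume A: "A \<in> Pow E"
    have nE: "num_components V E = 1" using num_components_eq_1_iff[OF assms(2)] assms(4) by simp
    show "(1 - 1) ^ (num_components V A - num_components V E) *
         (0 - 1) ^ (num_components V A + card A - card V) =
         (if connects V A then (-1) ^ Suc (card V) * (-1) ^ card A else 0 :: 'a)"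
    proof (cases "connects V A")
      case True
      then have "num_components V A = 1" using num_components_eq_1_iff[OF assms(2)] by simp
      \<comment> \<open>This bound makes the truncated subtraction in the exponent exact, so that
        its parity can be read off.\<close>
      moreover have "card V \<le> Suc (card A)"
        using connects_card_le[OF _ True] A assms finite_subset by auto
      then have "(-1 :: 'a) ^ (Suc (card A) - card V) = (-1) ^ (Suc (card A) + card V)"
        by (rule neg_one_power_add_eq_neg_one_power_diff[symmetric])
      ultimately show ?thesis using True nE by (simp add: power_add)
    next
      case False
      then have "num_components V A \<noteq> 1" "num_components V A > 0"
        using num_components_eq_1_iff[OF assms(2)] num_components_pos[OF assms(1,2)] by simp_all
      then show ?thesis using False nE by (simp add: power_0_left)
    qed
  qed
  also have "\<dots> = (-1) ^ Suc (card V) * conn_sum V E"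
    unfolding conn_sum_def sum_distrib_left using assms(3)
    by (subst sum.inter_filter[symmetric]) (simp_all add: Pow_def)
  finally show ?thesis .
qed

subsection \<open>Crossing graphs\<close>

definition crossings :: "nat set set \<Rightarrow> nat set set set" where
  "crossings P = {{b, c} | b c. b \<in> P \<and> c \<in> P \<and> crosses b c}"

lemma crossing_graph_eq: "crossing_graph P = (P, crossings P)"
  by (simp add: crossing_graph_def crossings_def)

lemma crosses_sym: "crosses b c \<Longrightarrow> crosses c b"
  unfolding crosses_def by blast

lemma doubleton_in_crossings_iff: "{b, c} \<in> crossings P \<longleftrightarrow> b \<in> P \<and> c \<in> P \<and> crosses b c"
proof
  assume "{b, c} \<in> crossings P"
  then obtain b' c' where "{b, c} = {b', c'}" "b' \<in> P" "c' \<in> P" "crosses b' c'"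
    unfolding crossings_def by blast
  then show "b \<in> P \<and> c \<in> P \<and> crosses b c" using crosses_sym by (auto simp: doubleton_eq_iff)
qed (auto simp: crossings_def)

text \<open>Crossing graphs of sub-collections are induced subgraphs; this translates the graph
  identity into one about partitions.\<close>

lemma crossings_Int_Pow: "C \<subseteq> P \<Longrightarrow> crossings P \<inter> Pow C = crossings C"
  by (auto simp: crossings_def)

lemma crossings_eq_empty_iff: "crossings P = {} \<longleftrightarrow> (\<forall>b\<in>P. \<forall>c\<in>P. \<not> crosses b c)"
  unfolding crossings_def by blast

lemma finite_crossings: "finite P \<Longrightarrow> finite (crossings P)"
  by (rule finite_subset[of _ "Pow P"]) (auto simp: crossings_def)

section \<open>Connected partitions are those with a connected crossing graph\<close>

lemma crosses_between:
  assumes "crosses b c"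
  obtains x y z where "x \<in> b" "y \<in> b" "z \<in> c" "x < z" "z < y"
  using assms unfolding crosses_def by blast

text \<open>Let the blocks in \<open>Q\<close> fill a proper subinterval. A block crossing one of
  them has a point between two points of the interval, hence belongs to \<open>Q\<close>. So no path
  leaves \<open>Q\<close>.\<close>

lemma not_connects_crossings:
  assumes P: "partition_on {1..n} P" and "P \<notin> connected_partitions n" "A \<subseteq> crossings P"
  shows "\<not> connects P A"
proof
  assume conn: "connects P A"
  obtain a b Q where Q: "a \<le> b" "{a..b} \<subset> {1..n}" "Q \<subseteq> P" "\<Union>Q = {a..b}"
    using assms by (auto simp: connected_partitions_def)
  obtain p where p: "p \<in> Q" using Q(1,4) by fastforce
  obtain q where q: "q \<in> P" "q \<notin> Q"
    using Q partition_onD1[OF P] by blast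
  have "(p, q) \<in> (adj A)\<^sup>*" using conn p q Q(3) by (auto simp: connects_def)
  then have "q \<in> Q"
  proof (rule adj_rtrancl_invariant[OF _ p])
    fix c d assume "{c, d} \<in> A" "c \<in> Q"
    then have cd: "d \<in> P" "crosses c d" using assms(3) doubleton_in_crossings_iff by blast+
    obtain x y z where xyz: "x \<in> c" "y \<in> c" "z \<in> d" "x < z" "z < y"
      using crosses_between[OF cd(2)] .
    have "x \<in> {a..b}" "y \<in> {a..b}" using xyz \<open>c \<in> Q\<close> Q(4) by blast+
    then have "z \<in> \<Union>Q" using xyz Q(4) by auto
    then obtain e where "e \<in> Q" "z \<in> e" by blast
    then have "d = e" using cd(1) xyz(3) Q(3) partition_onD2[OF P] unfolding disjoint_def by blast
    then show "d \<in> Q" using \<open>e \<in> Q\<close> by simp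
  qed
  then show False using q(2) by simp
qed

text \<open>If no block straddles \<open>y\<close>, then a block with a point left of
  \<open>y\<close> lies entirely to the left, and any block crossing it has a point there too. Along
  a path from the block of \<open>a\<close> this contradicts the block of \<open>b\<close>.\<close>

lemma connected_blocks_straddle:
  assumes conn: "\<And>c d. c \<in> C \<Longrightarrow> d \<in> C \<Longrightarrow> (c, d) \<in> (adj (crossings P))\<^sup>*"
    and y: "y \<notin> \<Union>C" and closed: "\<And>c d. c \<in> C \<Longrightarrow> {c, d} \<in> crossings P \<Longrightarrow> d \<in> C"
    and a: "a \<in> \<Union>C" "a < y" and b: "b \<in> \<Union>C" "y < b"
  obtains c where "c \<in> C" "\<exists>i\<in>c. i < y" "\<exists>j\<in>c. y < j"
proof (rule ccontr)
  note straddle = that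
  assume "\<not> thesis"
  then have no: "\<not> ((\<exists>i\<in>c. i < y) \<and> (\<exists>j\<in>c. y < j))" if "c \<in> C" for c
    using straddle[OF that] by blast
  obtain p where p: "p \<in> C" "a \<in> p" using a by blast
  obtain q where q: "q \<in> C" "b \<in> q" using b by blast
  have "q \<in> {c \<in> C. \<exists>i\<in>c. i < y}"
  proof (rule adj_rtrancl_invariant[OF conn[OF p(1) q(1)]])
    show "p \<in> {c \<in> C. \<exists>i\<in>c. i < y}" using p a(2) by blast
    fix c d assume cd: "{c, d} \<in> crossings P" "c \<in> {c \<in> C. \<exists>i\<in>c. i < y}"
    then have "crosses c d" "d \<in> C" using closed doubleton_in_crossings_iff by blast+
    obtain u v z where z: "u \<in> c" "v \<in> c" "z \<in> d" "u < z" "z < v"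
      using crosses_between[OF \<open>crosses c d\<close>] .
    have "\<not> y < v" using no[of c] cd(2) z(2) by blast
    then have "z < y" using z(5) by linarith
    then show "d \<in> {c \<in> C. \<exists>i\<in>c. i < y}" using z(3) \<open>d \<in> C\<close> by blast
  qed
  then show False using no[OF q(1)] q(2) b(2) by blast
qed

text \<open>
  A component of the crossing graph that leaves out a point strictly inside its span has a
  block straddling that point, and the component of the point is nested strictly inside
  this block. So a component of minimal span covers a whole interval.
\<close>

lemma connects_crossings:
  assumes P: "P \<in> connected_partitions n"
  shows "connects P (crossings P)"
proof (cases "P = {}")
  case False
  have part: "partition_on {1..n} P" using P by (simp add: connected_partitions_def)
  define K where "K p = {v. (p, v) \<in> (adj (crossings P))\<^sup>*}" for p
  have KP: "K p \<subseteq> P" if "p \<in> P" for p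
  proof
    fix v assume "v \<in> K p"
    then show "v \<in> P" unfolding K_def
      using adj_rtrancl_invariant[of p v "crossings P" P] that doubleton_in_crossings_iff by blast
  qed
  have Kself: "p \<in> K p" for p by (simp add: K_def)
  have Kclosed: "d \<in> K p" if "c \<in> K p" "{c, d} \<in> crossings P" for c d p
  proof -
    have "(p, c) \<in> (adj (crossings P))\<^sup>*" "(c, d) \<in> adj (crossings P)"
      using that by (simp_all add: K_def adj_def)
    then show ?thesis unfolding K_def by (simp add: rtrancl_into_rtrancl)
  qed
  have Kconn: "(c, d) \<in> (adj (crossings P))\<^sup>*" if "c \<in> K p" "d \<in> K p" for c d p
  proof -
    have "(p, c) \<in> (adj (crossings P))\<^sup>*" "(p, d) \<in> (adj (crossings P))\<^sup>*"
      using that by (simp_all add: K_def)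
    then show ?thesis by (meson adj_rtrancl_sym rtrancl_trans)
  qed
  have ne: "p \<noteq> {}" "finite p" if "p \<in> P" for p
  proof -
    show "p \<noteq> {}" using that partition_onD3[OF part] by blast
    have "p \<subseteq> {1..n}" using that partition_onD1[OF part] by blast
    then show "finite p" using finite_subset by blast
  qed
  have disj: "c = d" if "c \<in> P" "d \<in> P" "x \<in> c" "x \<in> d" for c d x
    using that partition_onD2[OF part] unfolding disjoint_def by blast
  have finU: "finite (\<Union>(K p))" and neU: "\<Union>(K p) \<noteq> {}" if "p \<in> P" for p
  proof -
    have "\<Union>(K p) \<subseteq> {1..n}" using KP[OF that] partition_onD1[OF part] by blast
    then show "finite (\<Union>(K p))" using finite_subset by blast
    show "\<Union>(K p) \<noteq> {}" using ne(1)[OF that] Kself[of p] by blast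
  qed
  define span where "span p = Max (\<Union>(K p)) - Min (\<Union>(K p))" for p
  \<comment> \<open>Take a component of minimal span; the aim is to show that its union
    \<open>U\<close> has no gaps.\<close>
  obtain p where p: "p \<in> P" and least: "\<And>q. q \<in> P \<Longrightarrow> span p \<le> span q"
    using False ex_has_least_nat[of "\<lambda>p. p \<in> P" _ span] by blast
  define U where "U = \<Union>(K p)"
  have U: "finite U" "U \<noteq> {}" "U \<subseteq> {1..n}"
    using finU[OF p] neU[OF p] KP[OF p] partition_onD1[OF part] by (auto simp: U_def)
  have "{Min U..Max U} \<subseteq> U"
  proof
    fix y assume y: "y \<in> {Min U..Max U}"
    show "y \<in> U"
    proof (rule ccontr)
      assume yU: "y \<notin> U"
      have mm: "Min U \<in> U" "Max U \<in> U" using U by simp_all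
      then have lt: "Min U < y" "y < Max U" using y yU by (auto simp: le_less)
      obtain c i j where c: "c \<in> K p" and ij: "i \<in> c" "i < y" "j \<in> c" "y < j"
        using connected_blocks_straddle[of "K p" P y "Min U" "Max U"] Kconn Kclosed yU mm lt
        unfolding U_def by metis
      have cP: "c \<in> P" using c KP[OF p] by blast
      define lo hi where "lo = Min c" and "hi = Max c"
      have lohi: "lo \<in> c" "hi \<in> c" "lo < y" "y < hi"
      proof -
        show "lo \<in> c" "hi \<in> c" using ne[OF cP] by (simp_all add: lo_def hi_def)
        show "lo < y" using Min_le[OF ne(2)[OF cP] ij(1)] ij(2) unfolding lo_def by linarith
        show "y < hi" using Max_ge[OF ne(2)[OF cP] ij(3)] ij(4) unfolding hi_def by linarith
      qed
      have "y \<in> {1..n}" using y U mm by fastforce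
      then obtain q where q: "q \<in> P" "y \<in> q" using partition_onD1[OF part] by blast
      \<comment> \<open>No block outside the component of \<open>p\<close> crosses \<open>c\<close>.
        With one point strictly between the ends \<open>lo\<close> and \<open>hi\<close> of
        \<open>c\<close> and another beyond them, it would cross \<open>c\<close> at these
        ends.\<close>
      have sub: "d \<subseteq> {lo<..<hi}" if d: "d \<in> P" "d \<notin> K p" "z \<in> d" "lo < z" "z < hi" for d z
      proof
        fix w assume w: "w \<in> d"
        have "c \<noteq> d" using c d by blast
        have nc: "\<not> crosses c d"
          using Kclosed[OF c] d cP doubleton_in_crossings_iff[of c d P] by blast
        have "w \<notin> c" using disj[OF cP d(1)] w \<open>c \<noteq> d\<close> by blast
        then have "w \<noteq> lo" "w \<noteq> hi" using lohi by auto
        moreover have "\<not> w < lo"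
          using nc \<open>c \<noteq> d\<close> w lohi d(3-5) unfolding crosses_def by blast
        moreover have "\<not> w > hi"
          using nc \<open>c \<noteq> d\<close> w lohi d(3-5) unfolding crosses_def by blast
        ultimately show "w \<in> {lo<..<hi}" by simp
      qed
      have notK: "d \<notin> K p" if "d \<in> K q" for d
      proof
        assume "d \<in> K p"
        then have "q \<in> K p"
          using that Kconn[of d p d] unfolding K_def by (auto dest: adj_rtrancl_sym rtrancl_trans)
        then show False using yU q(2) by (auto simp: U_def)
      qed
      \<comment> \<open>The confinement spreads along crossings: a block crossing a confined one has
        a point between two of its points, so \<open>sub\<close> applies to it.\<close>
      have "d \<in> {d \<in> K q. d \<subseteq> {lo<..<hi}}" if "d \<in> K q" for d
      proof (rule adj_rtrancl_invariant[of q d "crossings P"])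
        show "(q, d) \<in> (adj (crossings P))\<^sup>*" using that by (simp add: K_def)
        show "q \<in> {d \<in> K q. d \<subseteq> {lo<..<hi}}"
          using sub[OF q(1) notK[OF Kself] q(2) lohi(3,4)] Kself by blast
        fix e f assume ef: "{e, f} \<in> crossings P" "e \<in> {d \<in> K q. d \<subseteq> {lo<..<hi}}"
        then have f: "f \<in> K q" "f \<in> P" "crosses e f"
          using Kclosed doubleton_in_crossings_iff by blast+
        obtain u v z where z: "u \<in> e" "v \<in> e" "z \<in> f" "u < z" "z < v"
          using crosses_between[OF f(3)] .
        have "u \<in> {lo<..<hi}" "v \<in> {lo<..<hi}" using ef(2) z by blast+
        then have "lo < z" "z < hi" using z(4,5) by auto
        then show "f \<in> {d \<in> K q. d \<subseteq> {lo<..<hi}}"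
          using sub[OF f(2) notK[OF f(1)] z(3)] f(1) by blast
      qed
      then have "\<Union>(K q) \<subseteq> {lo<..<hi}" by blast
      moreover have "Min (\<Union>(K q)) \<in> \<Union>(K q)" "Max (\<Union>(K q)) \<in> \<Union>(K q)"
        using Min_in[OF finU neU] Max_in[OF finU neU] q(1) by blast+
      ultimately have "Min (\<Union>(K q)) \<in> {lo<..<hi}" "Max (\<Union>(K q)) \<in> {lo<..<hi}"
        by (meson subsetD)+
      then have "lo < Min (\<Union>(K q))" "Max (\<Union>(K q)) < hi"
        by (simp_all only: greaterThanLessThan_iff)
      moreover have "Min U \<le> lo" "hi \<le> Max U"
      proof -
        have "lo \<in> U" "hi \<in> U" using lohi(1,2) c unfolding U_def by blast+
        then show "Min U \<le> lo" "hi \<le> Max U" using U(1) by simp_all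
      qed
      \<comment> \<open>\<open>lo < y\<close> and \<open>y < hi\<close> ensure that
        \<open>span p\<close> is positive, as strictness under truncated subtraction
        requires.\<close>
      ultimately have "span q < span p" using lohi(3,4) unfolding span_def U_def by linarith
      then show False using least[OF q(1)] by simp
    qed
  qed
  then have "U = {Min U..Max U}" using U by auto
  moreover have "Min U \<le> Max U" using U by simp
  \<comment> \<open>\<open>U\<close> is an interval and a union of blocks, so connectedness of the
    partition leaves no other choice.\<close>
  ultimately have "U = {1..n}"
    using P U(3) KP[OF p] unfolding connected_partitions_def U_def
    by (metis (mono_tags, lifting) mem_Collect_eq psubsetI)
  have "P \<subseteq> K p"
  proof
    fix q assume q: "q \<in> P"
    then obtain x where "x \<in> q" using ne by blast
    moreover have "x \<in> U" using \<open>U = {1..n}\<close> \<open>x \<in> q\<close> q partition_onD1[OF part] by blast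
    ultimately show "q \<in> K p" using disj[OF q] KP[OF p] unfolding U_def by blast
  qed
  then show ?thesis unfolding connects_def using Kconn by blast
qed (simp add: connects_def)

subsection \<open>The moment-cumulant recursion\<close>

unbundle fps_syntax

text \<open>The ground set is arbitrary because the recursion passes to complements
  \<open>S - T\<close>. The indicator has the form of the left side of
  \<open>edgeless_eq_sum_conn_sum\<close>.\<close>

definition noncrossing_sum :: "nat set \<Rightarrow> 'a::field_char_0 \<Rightarrow> 'a" where
  "noncrossing_sum S lam =
     (\<Sum>P | partition_on S P. lam ^ card P * (if crossings P = {} then 1 else 0))"

text \<open>For \<open>{1..n}\<close> with n positive this is the right-hand side of the theorem:
  partitions that are not connected contribute 0.\<close>

definition connected_sum :: "nat set \<Rightarrow> 'a::field_char_0 \<Rightarrow> 'a" where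
  "connected_sum S lam = (\<Sum>P | partition_on S P. lam ^ card P * conn_sum P (crossings P))"

text \<open>With \<open>partition_on_join\<close>, this trades a partition with a chosen
  sub-collection for a subset \<open>T\<close> and partitions of \<open>T\<close> and
  \<open>S - T\<close>.\<close>

lemma partition_on_split:
  assumes "partition_on S P" "C \<subseteq> P"
  shows "partition_on (\<Union>C) C" "partition_on (S - \<Union>C) (P - C)"
proof -
  have disj: "disjoint P" "{} \<notin> P" "\<Union>P = S" using assms(1) by (auto simp: partition_on_def)
  show "partition_on (\<Union>C) C"
    using disj assms(2) by (auto simp: partition_on_def intro: pairwise_subset)
  have "\<Union>(P - C) = S - \<Union>C"
  proof
    show "\<Union>(P - C) \<subseteq> S - \<Union>C" using disj assms(2) by (fastforce simp: disjoint_def)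
    show "S - \<Union>C \<subseteq> \<Union>(P - C)" using disj by blast
  qed
  then show "partition_on (S - \<Union>C) (P - C)"
    using disj by (auto simp: partition_on_def intro: pairwise_subset)
qed

lemma partition_on_join:
  assumes "partition_on T C" "partition_on (S - T) D" "T \<subseteq> S"
  shows "partition_on S (C \<union> D)" "C \<inter> D = {}"
proof -
  have "\<Union>C = T" "\<Union>D = S - T" using assms by (auto simp: partition_on_def)
  show "C \<inter> D = {}"
  proof (rule ccontr)
    assume "C \<inter> D \<noteq> {}"
    then obtain p where "p \<in> C" "p \<in> D" by blast
    then have "p = {}" using \<open>\<Union>C = T\<close> \<open>\<Union>D = S - T\<close> by blast
    then show False using \<open>p \<in> C\<close> assms(1) by (auto simp: partition_on_def)
  qed
  have "p \<inter> q = {}" if "p \<in> C" "q \<in> D" for p q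
    using that \<open>\<Union>C = T\<close> \<open>\<Union>D = S - T\<close> by blast
  then have "disjoint (C \<union> D)"
    using assms(1,2) by (intro disjoint_union) (auto simp: partition_on_def \<open>\<Union>C = T\<close> \<open>\<Union>D = S - T\<close>)
  then show "partition_on S (C \<union> D)"
    using assms \<open>\<Union>C = T\<close> \<open>\<Union>D = S - T\<close> by (auto simp: partition_on_def)
qed

text \<open>Apply the graph identity to each partition, at the block containing \<open>x\<close>,
  and exchange sums: first choose the union \<open>T\<close> of the component, then partition
  \<open>T\<close> and \<open>S - T\<close> independently. The weight \<open>lam ^ card P\<close> is
  multiplicative.\<close>

lemma noncrossing_sum_rec:
  assumes S: "finite S" "x \<in> S"
  shows "noncrossing_sum S lam =
    (\<Sum>T | T \<subseteq> S \<and> x \<in> T. connected_sum T lam * noncrossing_sum (S - T) lam)"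
proof -
  define w where "w P = (if crossings P = {} then 1 else 0 :: 'a)" for P
  have fin: "finite {P. partition_on T P}" if "T \<subseteq> S" for T
    using finitely_many_partition_on finite_subset[OF that S(1)] by blast
  have finP: "finite P" if "partition_on S P" for P using finite_elements[OF S(1) that] .
  have step: "w P = (\<Sum>C | C \<subseteq> P \<and> x \<in> \<Union>C. conn_sum C (crossings C) * w (P - C))"
    if P: "partition_on S P" for P
  proof -
    obtain b where b: "b \<in> P" "x \<in> b" using S(2) partition_onD1[OF P] by blast
    have "crossings P \<subseteq> {{u, v} |u v. u \<in> P \<and> v \<in> P}" "{} \<notin> crossings P"
      by (auto simp: crossings_def)
    from edgeless_eq_sum_conn_sum[OF finP[OF P] this b(1), where 'a='a]
    have "w P = (\<Sum>C | C \<subseteq> P \<and> b \<in> C.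
      conn_sum C (crossings P \<inter> Pow C) * (if crossings P \<inter> Pow (P - C) = {} then 1 else 0))"
      by (simp add: w_def)
    also have "\<dots> = (\<Sum>C | C \<subseteq> P \<and> x \<in> \<Union>C. conn_sum C (crossings C) * w (P - C))"
    proof (rule sum.cong)
      \<comment> \<open>As \<open>b\<close> is the only block containing \<open>x\<close>, the
        condition on \<open>C\<close> can be stated without \<open>b\<close>, which depends on
        \<open>P\<close>.\<close>
      have "c = b" if "c \<in> P" "x \<in> c" for c
        using that b partition_onD2[OF P] unfolding disjoint_def by blast
      then have "b \<in> C \<longleftrightarrow> x \<in> \<Union>C" if "C \<subseteq> P" for C
        using that b(2) by (metis UnionE UnionI subsetD)
      then show "{C. C \<subseteq> P \<and> b \<in> C} = {C. C \<subseteq> P \<and> x \<in> \<Union>C}" by blast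
    qed (simp add: w_def crossings_Int_Pow)
    finally show ?thesis .
  qed
  have "noncrossing_sum S lam = (\<Sum>P | partition_on S P.
      \<Sum>C | C \<subseteq> P \<and> x \<in> \<Union>C. lam ^ card P * (conn_sum C (crossings C) * w (P - C)))"
    unfolding noncrossing_sum_def sum_distrib_left[symmetric]
    using step by (intro sum.cong refl) (simp add: w_def[symmetric])
  also have "\<dots> = (\<Sum>(P, C) \<in> Sigma {P. partition_on S P} (\<lambda>P. {C. C \<subseteq> P \<and> x \<in> \<Union>C}).
      lam ^ card P * (conn_sum C (crossings C) * w (P - C)))"
    by (rule sum.Sigma) (use fin finP in auto)
  also have "\<dots> = (\<Sum>(T, C, D) \<in> Sigma {T. T \<subseteq> S \<and> x \<in> T}
        (\<lambda>T. {C. partition_on T C} \<times> {D. partition_on (S - T) D}).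
      (lam ^ card C * conn_sum C (crossings C)) * (lam ^ card D * w D))"
  proof (rule sum.reindex_bij_witness[of _ "\<lambda>(T, C, D). (C \<union> D, C)" "\<lambda>(P, C). (\<Union>C, C, P - C)"],
      goal_cases)
    case (1 p)
    then show ?case by auto
  next
    case (2 p)
    then obtain P C where p: "p = (P, C)" "partition_on S P" "C \<subseteq> P" "x \<in> \<Union>C" by auto
    have "\<Union>C \<subseteq> S" using p partition_onD1 by blast
    then show ?case using p partition_on_split[OF p(2,3)] by simp
  next
    case (3 t)
    then obtain T C D where t: "t = (T, C, D)" "T \<subseteq> S" "x \<in> T" "partition_on T C"
      "partition_on (S - T) D" by auto
    then show ?case using partition_on_join(2)[OF t(4,5,2)] partition_onD1[OF t(4)] by auto
  next
    case (4 t)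
    then obtain T C D where t: "t = (T, C, D)" "T \<subseteq> S" "x \<in> T" "partition_on T C"
      "partition_on (S - T) D" by auto
    then show ?case using partition_on_join(1)[OF t(4,5,2)] partition_onD1[OF t(4)] by auto
  next
    case (5 p)
    then obtain P C where p: "p = (P, C)" "partition_on S P" "C \<subseteq> P" by auto
    have "card P = card C + card (P - C)"
      using p finP card_Diff_subset[of C P] card_mono[of P C] finite_subset by fastforce
    then show ?case using p by (simp add: power_add mult_ac)
  qed
  also have "\<dots> = (\<Sum>T | T \<subseteq> S \<and> x \<in> T. \<Sum>(C, D) \<in> {C. partition_on T C} \<times> {D. partition_on (S - T) D}.
      (lam ^ card C * conn_sum C (crossings C)) * (lam ^ card D * w D))"
    by (rule sum.Sigma[symmetric]) (use S(1) fin in auto)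
  also have "\<dots> = (\<Sum>T | T \<subseteq> S \<and> x \<in> T. connected_sum T lam * noncrossing_sum (S - T) lam)"
    unfolding connected_sum_def noncrossing_sum_def w_def sum_product sum.cartesian_product ..
  finally show ?thesis .
qed

section \<open>Invariance under order-preserving relabelling\<close>

lemma crosses_image_iff:
  assumes f: "strict_mono_on S f" and bc: "b \<subseteq> S" "c \<subseteq> S"
  shows "crosses (f ` b) (f ` c) \<longleftrightarrow> crosses b c"
proof -
  have inj: "inj_on f S" using f by (rule strict_mono_on_imp_inj_on)
  have eq: "f ` b = f ` c \<longleftrightarrow> b = c" using inj_on_image_eq_iff[OF inj bc] .
  have less: "f i < f j \<longleftrightarrow> i < j" if "i \<in> S" "j \<in> S" for i j
    using strict_mono_on_less[OF f that] .
  \<comment> \<open>One of the two alternatives in \<open>crosses\<close>; the other follows by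
    exchanging \<open>b\<close> and \<open>c\<close>.\<close>
  have aux: "(\<exists>i k j l. i < k \<and> k < j \<and> j < l \<and> i \<in> f ` b \<and> j \<in> f ` b \<and> k \<in> f ` c \<and> l \<in> f ` c) \<longleftrightarrow>
      (\<exists>i k j l. i < k \<and> k < j \<and> j < l \<and> i \<in> b \<and> j \<in> b \<and> k \<in> c \<and> l \<in> c)" (is "?L \<longleftrightarrow> ?R")
    if "b \<subseteq> S" "c \<subseteq> S" for b c
  proof
    assume ?L
    then obtain i k j l where *: "i \<in> b" "j \<in> b" "k \<in> c" "l \<in> c" "f i < f k" "f k < f j" "f j < f l"
      by blast
    then have "i < k" "k < j" "j < l" using less that by (meson subsetD)+
    then show ?R using * by blast
  next
    assume ?R
    then obtain i k j l where *: "i \<in> b" "j \<in> b" "k \<in> c" "l \<in> c" "i < k" "k < j" "j < l"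
      by blast
    then have "f i < f k" "f k < f j" "f j < f l" using less that by (meson subsetD)+
    then show ?L using * by blast
  qed
  show ?thesis
    unfolding crosses_def eq using aux[OF bc] aux[OF bc(2,1)] by (simp add: conj_disj_distribL ex_disj_distrib)
qed

text \<open>Crossings depend only on the relative order of the points, so taking images of blocks
  matches the partitions and their weights.\<close>

lemma noncrossing_sum_image:
  assumes f: "strict_mono_on S f"
  shows "noncrossing_sum (f ` S) lam = noncrossing_sum S lam"
proof -
  have inj: "inj_on f S" using f by (rule strict_mono_on_imp_inj_on)
  define g where "g = inv_into S f"
  have gf: "g ` f ` b = b" if "b \<subseteq> S" for b
    using inv_into_image_cancel[OF inj that] by (simp add: g_def)
  have fg: "f ` g ` b = b" if "b \<subseteq> f ` S" for b
    using image_inv_into_cancel[OF refl that] by (simp add: g_def)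
  have sub: "b \<subseteq> S" if "partition_on S P" "b \<in> P" for S :: "nat set" and P b
    using that by (auto simp: partition_on_def)
  have gfP: "(`) g ` (`) f ` P = P" if "partition_on S P" for P
    using gf sub[OF that] by (force simp: image_image)
  have fgP: "(`) f ` (`) g ` P = P" if "partition_on (f ` S) P" for P
    using fg sub[OF that] by (force simp: image_image)
  have part: "partition_on (h ` S) ((`) h ` P)" if "partition_on S P" "inj_on h S"
    for S P and h :: "nat \<Rightarrow> nat"
  proof -
    have "{} \<notin> (`) h ` P" using partition_onD3[OF that(1)] by auto
    then show ?thesis using partition_on_inj_image[OF that] by simp
  qed
  show ?thesis
    unfolding noncrossing_sum_def
  proof (rule sum.reindex_bij_witness[of _ "(`) ((`) f)" "(`) ((`) g)"], goal_cases)
    case (1 P)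
    then show ?case using fgP by simp
  next
    case (2 P)
    moreover have "inj_on g (f ` S)" unfolding g_def by (rule inj_on_inv_into) simp
    ultimately show ?case using part[of "f ` S" P g] gf[of S] by simp
  next
    case (3 P)
    then show ?case using gfP by simp
  next
    case (4 P)
    then show ?case using part[of S P f] inj by simp
  next
    case (5 P)
    then have P: "partition_on (f ` S) P" by simp
    have subg: "g ` b \<subseteq> S" if "b \<in> P" for b
      using sub[OF P that] inv_into_into[of _ f S] by (auto simp: g_def)
    have "inj_on ((`) g) P"
      by (rule inj_on_inverseI[of _ "(`) f"]) (use fg sub[OF P] in auto)
    then have "card ((`) g ` P) = card P" by (rule card_image)
    moreover have "crosses (g ` b) (g ` c) \<longleftrightarrow> crosses b c" if "b \<in> P" "c \<in> P" for b c
      using crosses_image_iff[OF f subg[OF that(1)] subg[OF that(2)]] that fg sub[OF P] by simp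
    then have "crossings ((`) g ` P) = {} \<longleftrightarrow> crossings P = {}"
      unfolding crossings_eq_empty_iff by simp
    ultimately show ?case by simp
  qed
qed

lemma noncrossing_sum_eq_moment:
  assumes "finite S"
  shows "noncrossing_sum S lam = free_poisson_moment (card S) lam"
proof -
  define n where "n = card S"
  obtain h where h: "bij_betw h {..<n} S" "strict_mono_on {..<n} h"
    using ex_bij_betw_strict_mono_card[OF assms] unfolding n_def by blast
  have "noncrossing_sum S lam = noncrossing_sum {..<n} lam"
    using noncrossing_sum_image[OF h(2), of lam] h(1) by (simp add: bij_betw_def)
  \<comment> \<open>The enumeration of \<open>S\<close> starts at 0, whereas moments are defined on
    \<open>{1..n}\<close>; the shift is \<open>Suc\<close>.\<close>
  also have "\<dots> = noncrossing_sum {1..n} lam"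
    using noncrossing_sum_image[of "{..<n}" Suc lam]
    by (simp add: strict_mono_on_def image_Suc_lessThan)
  also have "\<dots> = free_poisson_moment n lam"
    unfolding noncrossing_sum_def free_poisson_moment_def noncrossing_partitions_def
    by (rule sum.mono_neutral_cong_right)
       (auto simp: crossings_eq_empty_iff finitely_many_partition_on)
  finally show ?thesis by (simp add: n_def)
qed

section \<open>Moments and cumulants\<close>

lemma free_poisson_moment_0: "free_poisson_moment 0 lam = 1"
  by (simp add: free_poisson_moment_def noncrossing_partitions_def partition_on_empty
      Collect_conv_if cong: conj_cong)

text \<open>Compare coefficients in M' = K' M, where \<open>M\<close> and \<open>K\<close> are the
  exponential generating functions of moments and cumulants.\<close>

lemma free_poisson_moment_Suc:
  "free_poisson_moment (Suc n) lam =
    (\<Sum>i\<le>n. of_nat (n choose i) * free_poisson_cumulant (Suc i) lam * free_poisson_moment (n - i) lam)"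
proof -
  define M where "M = Abs_fps (\<lambda>m. free_poisson_moment m lam / fact m)"
  define K where "K = fps_ln 1 oo (M - 1)"
  have M0: "(M - 1) $ 0 = 0" "M $ 0 \<noteq> 0" by (simp_all add: M_def free_poisson_moment_0)
  \<comment> \<open>Chain rule for log(1 + z) at \<open>M - 1\<close>; the outer derivative becomes
    \<open>inverse M\<close>.\<close>
  have "fps_deriv K = (inverse (1 + fps_X) oo (M - 1)) * fps_deriv M"
    unfolding K_def by (subst fps_compose_deriv[OF M0(1)]) (simp add: fps_ln_deriv)
  also have "inverse (1 + fps_X) oo (M - 1) = inverse M"
    by (subst fps_inverse_compose[OF M0(1)])
       (simp_all add: fps_compose_add_distrib fps_X_fps_compose_startby0[OF M0(1)])
  finally have "fps_deriv K * M = (inverse M * M) * fps_deriv M" by (simp add: mult_ac)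
  then have "fps_deriv M = fps_deriv K * M" using inverse_mult_eq_1[OF M0(2)] by simp
  then have "fps_deriv M $ n = (\<Sum>i=0..n. fps_deriv K $ i * M $ (n - i))"
    by (simp only: fps_mult_nth)
  moreover have "fact n * fps_deriv M $ n = free_poisson_moment (Suc n) lam"
    by (simp add: M_def field_simps del: of_nat_Suc)
  \<comment> \<open>\<open>fps_deriv K $ i\<close> is the cumulant of index \<open>Suc i\<close>
    divided by \<open>fact i\<close>; the factorials combine to a binomial coefficient.\<close>
  moreover have "fact n * (fps_deriv K $ i * M $ (n - i)) =
      of_nat (n choose i) * free_poisson_cumulant (Suc i) lam * free_poisson_moment (n - i) lam"
    if "i \<le> n" for i
    using that by (simp add: free_poisson_cumulant_def K_def M_def binomial_fact field_simps)
  ultimately show ?thesis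
    by (simp add: sum_distrib_left atMost_atLeast0)
qed

text \<open>Strong induction on the size: \<open>noncrossing_sum_rec\<close> and
  \<open>free_poisson_moment_Suc\<close> expand the same moment, and their terms agree for all
  proper subsets \<open>T\<close>. The term of \<open>S\<close> has factor
  \<open>noncrossing_sum {} lam\<close> = 1, so it agrees as well.\<close>

lemma connected_sum_eq_cumulant:
  assumes "finite S" "S \<noteq> {}"
  shows "connected_sum S lam = free_poisson_cumulant (card S) lam"
  using assms
proof (induction "card S" arbitrary: S rule: less_induct)
  case less
  then obtain x where x: "x \<in> S" by blast
  define n where "n = card S - 1"
  have n: "card S = Suc n" using less.prems by (simp add: n_def card_gt_0_iff)
  define F where "F = {T. T \<subseteq> S \<and> x \<in> T}"
  have F: "finite F" "S \<in> F" using less.prems x by (auto simp: F_def)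
  \<comment> \<open>The value shared by all \<open>T\<close> with \<open>i + 1\<close> elements; the
    shift accounts for the fixed point \<open>x\<close>.\<close>
  define c where "c i = free_poisson_cumulant (Suc i) lam * free_poisson_moment (n - i) lam" for i
  \<comment> \<open>Removing \<open>x\<close> turns these \<open>T\<close> into the
    \<open>i\<close>-element subsets of the \<open>n\<close>-element set
    \<open>S - {x}\<close>.\<close>
  have count: "card {T \<in> F. card T - 1 = i} = n choose i" for i
  proof -
    have "bij_betw (insert x) {T. T \<subseteq> S - {x} \<and> card T = i} {T \<in> F. card T - 1 = i}"
    proof (rule bij_betw_byWitness[where f' = "\<lambda>T. T - {x}"])
      show "insert x ` {T. T \<subseteq> S - {x} \<and> card T = i} \<subseteq> {T \<in> F. card T - 1 = i}"
      proof clarify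
        fix T assume T: "T \<subseteq> S - {x}" "i = card T"
        then have "finite T" "x \<notin> T" using less.prems finite_subset by auto
        then show "insert x T \<in> F \<and> card (insert x T) - 1 = card T"
          using T x by (auto simp: F_def)
      qed
    qed (auto simp: F_def)
    then have "card {T \<in> F. card T - 1 = i} = card {T. T \<subseteq> S - {x} \<and> card T = i}"
      by (rule bij_betw_same_card[symmetric])
    also have "\<dots> = n choose i"
      using n_subsets[of "S - {x}" i] less.prems x by (simp add: n_def)
    finally show ?thesis .
  qed
  have other: "connected_sum T lam * noncrossing_sum (S - T) lam = c (card T - 1)" if "T \<in> F - {S}" for T
  proof -
    have T: "T \<subset> S" "x \<in> T" "finite T" using that less.prems finite_subset by (auto simp: F_def)
    then have "card T < card S" "card T > 0" using less.prems psubset_card_mono card_gt_0_iff by blast+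
    then show ?thesis
      using less.hyps[of T] T noncrossing_sum_eq_moment[of "S - T" lam] less.prems n
      by (auto simp: c_def card_Diff_subset)
  qed
  have "noncrossing_sum S lam = (\<Sum>T\<in>F. connected_sum T lam * noncrossing_sum (S - T) lam)"
    using noncrossing_sum_rec[OF less.prems(1) x] by (simp add: F_def)
  also have "\<dots> = connected_sum S lam + (\<Sum>T\<in>F - {S}. c (card T - 1))"
    using F other noncrossing_sum_eq_moment[of "{}" lam]
    by (simp add: sum.remove[of F S] free_poisson_moment_0)
  finally have 1: "noncrossing_sum S lam = connected_sum S lam + (\<Sum>T\<in>F - {S}. c (card T - 1))" .
  have "noncrossing_sum S lam = (\<Sum>i\<le>n. of_nat (n choose i) * c i)"
    using noncrossing_sum_eq_moment[OF less.prems(1), of lam] free_poisson_moment_Suc[of n lam]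
    by (simp add: n c_def mult.assoc)
  also have "\<dots> = (\<Sum>i\<le>n. \<Sum>T\<in>{T \<in> F. card T - 1 = i}. c (card T - 1))"
    by (intro sum.cong refl) (simp add: count[symmetric])
  also have "\<dots> = (\<Sum>T\<in>F. c (card T - 1))"
  proof (rule sum.group)
    show "(\<lambda>T. card T - 1) ` F \<subseteq> {..n}"
    proof (rule image_subsetI)
      fix T assume "T \<in> F"
      then have "card T \<le> Suc n" using card_mono[OF less.prems(1), of T] n by (simp add: F_def)
      then show "card T - 1 \<in> {..n}" by simp
    qed
  qed (use F in auto)
  also have "\<dots> = free_poisson_cumulant (card S) lam + (\<Sum>T\<in>F - {S}. c (card T - 1))"
    using F by (simp add: sum.remove[of F S] c_def n free_poisson_moment_0)
  finally show ?case using 1 by simp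
qed

theorem theorem7p1:
  fixes n :: nat and lam :: "'a::field_char_0"
  assumes "n \<ge> 1"
  shows "free_poisson_cumulant n lam =
    - (\<Sum>P\<in>connected_partitions n. (- lam) ^ card P * tutte (crossing_graph P) 1 0)"
proof -
  \<comment> \<open>The signs \<open>(-1) ^ card P\<close> from \<open>- lam\<close> and
    \<open>(-1) ^ Suc (card P)\<close> from \<open>tutte_1_0\<close> multiply to -1.\<close>
  have tutte: "lam ^ card P * conn_sum P (crossings P) =
      - ((- lam) ^ card P * tutte (crossing_graph P) 1 0)"
    if P: "P \<in> connected_partitions n" for P
  proof -
    have part: "partition_on {1..n} P" using P by (simp add: connected_partitions_def)
    have "finite P" using finite_elements[OF _ part] by simp
    moreover have "P \<noteq> {}" using partition_onD1[OF part] assms by auto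
    ultimately have "tutte (crossing_graph P) 1 0 =
        (-1) ^ Suc (card P) * (conn_sum P (crossings P) :: 'a)"
      unfolding crossing_graph_eq
      using finite_crossings connects_crossings[OF P] by (intro tutte_1_0)
    moreover have "(- lam) ^ card P = (-1) ^ card P * lam ^ card P" by (rule power_minus)
    moreover have "(-1) ^ card P * (-1) ^ card P = (1 :: 'a)"
      by (simp flip: power_mult_distrib)
    ultimately show ?thesis by simp
  qed
  have zero: "conn_sum P (crossings P) = (0 :: 'a)"
    if "partition_on {1..n} P" "P \<notin> connected_partitions n" for P
  proof -
    have "{A. A \<subseteq> crossings P \<and> connects P A} = {}" using not_connects_crossings[OF that] by blast
    then show ?thesis unfolding conn_sum_def by (simp only: sum.empty)
  qed
  have "free_poisson_cumulant n lam = connected_sum {1..n} lam"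
    using connected_sum_eq_cumulant[of "{1..n}" lam] assms by simp
  \<comment> \<open>Partitions that are not connected drop out, since no set of crossings connects
    their blocks.\<close>
  also have "\<dots> = (\<Sum>P\<in>connected_partitions n. lam ^ card P * conn_sum P (crossings P))"
    unfolding connected_sum_def
    by (rule sum.mono_neutral_right)
       (use zero in \<open>auto simp: connected_partitions_def finitely_many_partition_on\<close>)
  also have "\<dots> = - (\<Sum>P\<in>connected_partitions n. (- lam) ^ card P * tutte (crossing_graph P) 1 0)"
    using tutte by (simp add: sum_negf[symmetric])
  finally show ?thesis .
qed

end
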